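(* Let $\mathcal{C}$ be a right exact category (respectively, a strongly right exact category), let $\mathcal{D}$ be a right quasi-abelian category, and let $L:\mathcal{D}\to\mathcal{C}$ be an additive functor which preserves cokernels. Then there is an induced right exact structure (respectively, strongly right exact structure) on $\mathcal{D}$ defined by the property that a kernel $j$ in $\mathcal{D}$ is an inflation if and only if $L(j)$ is an inflation in $\mathcal{C}$.
   Context: A right exact category is an additive category $\mathcal{C}$ endowed with a distinguished class of kernels (morphisms that are kernels of some morphism), called inflations, such that: [R0] the identity morphism $1_0:0\to 0$ is an inflation; [R1] the composition of any two inflations is an inflation; [R2] the pushout of any inflation along an arbitrary morphism exists and is again an inflation. Such a class of inflations is called a right exact structure. A right exact category is strongly right exact if moreover: [R3] if $i:A\to B$ and $p:B\to C$ are morphisms such that $i$ has a cokernel and $pi$ is an inflation, then $i$ is an inflation. An additive category is pre-abelian if every morphism has a kernel and a cokernel. It is right quasi-abelian if it is pre-abelian and kernels are stable under pushouts, i.e. the pushout of a kernel along an arbitrary morphism is a kernel. *)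

theory Defs
  imports "HOL-Algebra.Group"
begin

text \<open>
  A category is given by explicit carriers of objects and morphisms.  The record also
  carries the operations of an enrichment in abelian groups (zero morphisms and addition of
  parallel morphisms).  Composition is written in the usual order: \<open>g \<cdot> f\<close> means \<open>g\<close> after \<open>f\<close>.
\<close>

record ('o, 'm) precat =
  Obj :: "'o set"
  Mor :: "'m set"
  Dom :: "'m \<Rightarrow> 'o"
  Cod :: "'m \<Rightarrow> 'o"
  Ident :: "'o \<Rightarrow> 'm"
  comp :: "'m \<Rightarrow> 'm \<Rightarrow> 'm"  (infixl \<open>\<cdot>\<index>\<close> 70)
  zero_mor :: "'o \<Rightarrow> 'o \<Rightarrow> 'm"
  add_mor :: "'m \<Rightarrow> 'm \<Rightarrow> 'm"  (infixl \<open>\<boxplus>\<index>\<close> 65)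

definition Hom :: "('o, 'm) precat \<Rightarrow> 'o \<Rightarrow> 'o \<Rightarrow> 'm set" where
  "Hom C A B = {f \<in> Mor C. Dom C f = A \<and> Cod C f = B}"

definition Hom_group :: "('o, 'm) precat \<Rightarrow> 'o \<Rightarrow> 'o \<Rightarrow> 'm monoid" where
  "Hom_group C A B = \<lparr>carrier = Hom C A B, mult = add_mor C, one = zero_mor C A B\<rparr>"

locale category =
  fixes C :: "('o, 'm) precat" (structure)
  assumes Dom_in: "f \<in> Mor C \<Longrightarrow> Dom C f \<in> Obj C"
    and Cod_in: "f \<in> Mor C \<Longrightarrow> Cod C f \<in> Obj C"
    and Ident_in: "X \<in> Obj C \<Longrightarrow> Ident C X \<in> Hom C X X"
    and comp_in: "\<lbrakk>f \<in> Hom C X Y; g \<in> Hom C Y Z\<rbrakk> \<Longrightarrow> g \<cdot> f \<in> Hom C X Z"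
    and comp_Ident: "f \<in> Hom C X Y \<Longrightarrow> f \<cdot> Ident C X = f"
    and Ident_comp: "f \<in> Hom C X Y \<Longrightarrow> Ident C Y \<cdot> f = f"
    and comp_assoc:
      "\<lbrakk>f \<in> Hom C W X; g \<in> Hom C X Y; h \<in> Hom C Y Z\<rbrakk> \<Longrightarrow> (h \<cdot> g) \<cdot> f = h \<cdot> (g \<cdot> f)"

locale preadditive_category = category +
  assumes Hom_comm_group: "\<lbrakk>X \<in> Obj C; Y \<in> Obj C\<rbrakk> \<Longrightarrow> comm_group (Hom_group C X Y)"
    and comp_add_left:
      "\<lbrakk>f \<in> Hom C X Y; g \<in> Hom C Y Z; g' \<in> Hom C Y Z\<rbrakk> \<Longrightarrow> (g \<boxplus> g') \<cdot> f = (g \<cdot> f) \<boxplus> (g' \<cdot> f)"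
    and comp_add_right:
      "\<lbrakk>f \<in> Hom C X Y; f' \<in> Hom C X Y; g \<in> Hom C Y Z\<rbrakk> \<Longrightarrow> g \<cdot> (f \<boxplus> f') = (g \<cdot> f) \<boxplus> (g \<cdot> f')"

definition is_zero_object :: "('o, 'm) precat \<Rightarrow> 'o \<Rightarrow> bool" where
  "is_zero_object C Z \<longleftrightarrow> Z \<in> Obj C \<and>
     (\<forall>X \<in> Obj C. (\<exists>!f. f \<in> Hom C X Z) \<and> (\<exists>!f. f \<in> Hom C Z X))"

definition is_biproduct ::
    "('o, 'm) precat \<Rightarrow> 'o \<Rightarrow> 'o \<Rightarrow> 'o \<Rightarrow> 'm \<Rightarrow> 'm \<Rightarrow> 'm \<Rightarrow> 'm \<Rightarrow> bool" where
  "is_biproduct C X Y S i1 i2 p1 p2 \<longleftrightarrow>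
     i1 \<in> Hom C X S \<and> i2 \<in> Hom C Y S \<and> p1 \<in> Hom C S X \<and> p2 \<in> Hom C S Y \<and>
     p1 \<cdot>\<^bsub>C\<^esub> i1 = Ident C X \<and> p2 \<cdot>\<^bsub>C\<^esub> i2 = Ident C Y \<and>
     p2 \<cdot>\<^bsub>C\<^esub> i1 = zero_mor C X Y \<and> p1 \<cdot>\<^bsub>C\<^esub> i2 = zero_mor C Y X \<and>
     (i1 \<cdot>\<^bsub>C\<^esub> p1) \<boxplus>\<^bsub>C\<^esub> (i2 \<cdot>\<^bsub>C\<^esub> p2) = Ident C S"

locale additive_category = preadditive_category +
  assumes zero_object_exists: "\<exists>Z. is_zero_object C Z"
    and biproduct_exists:
      "\<lbrakk>X \<in> Obj C; Y \<in> Obj C\<rbrakk> \<Longrightarrow> \<exists>S i1 i2 p1 p2. is_biproduct C X Y S i1 i2 p1 p2"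

definition is_kernel_of :: "('o, 'm) precat \<Rightarrow> 'm \<Rightarrow> 'm \<Rightarrow> bool" where
  "is_kernel_of C k f \<longleftrightarrow>
     k \<in> Mor C \<and> f \<in> Mor C \<and> Cod C k = Dom C f \<and>
     f \<cdot>\<^bsub>C\<^esub> k = zero_mor C (Dom C k) (Cod C f) \<and>
     (\<forall>g \<in> Mor C. Cod C g = Dom C f \<and> f \<cdot>\<^bsub>C\<^esub> g = zero_mor C (Dom C g) (Cod C f) \<longrightarrow>
        (\<exists>!u. u \<in> Hom C (Dom C g) (Dom C k) \<and> k \<cdot>\<^bsub>C\<^esub> u = g))"

definition is_cokernel_of :: "('o, 'm) precat \<Rightarrow> 'm \<Rightarrow> 'm \<Rightarrow> bool" where
  "is_cokernel_of C c f \<longleftrightarrow>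
     c \<in> Mor C \<and> f \<in> Mor C \<and> Dom C c = Cod C f \<and>
     c \<cdot>\<^bsub>C\<^esub> f = zero_mor C (Dom C f) (Cod C c) \<and>
     (\<forall>g \<in> Mor C. Dom C g = Cod C f \<and> g \<cdot>\<^bsub>C\<^esub> f = zero_mor C (Dom C f) (Cod C g) \<longrightarrow>
        (\<exists>!u. u \<in> Hom C (Cod C c) (Cod C g) \<and> u \<cdot>\<^bsub>C\<^esub> c = g))"

definition is_kernel :: "('o, 'm) precat \<Rightarrow> 'm \<Rightarrow> bool" where
  "is_kernel C k \<longleftrightarrow> (\<exists>f. is_kernel_of C k f)"

text \<open>
  \<open>is_pushout C i f i' f'\<close>: the square \<open>i' \<cdot> f = f' \<cdot> i\<close> is a pushout square, so that \<open>i'\<close> is a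
  pushout of \<open>i\<close> along \<open>f\<close> (with \<open>i : A \<rightarrow> B\<close>, \<open>f : A \<rightarrow> A'\<close>, \<open>i' : A' \<rightarrow> B'\<close>, \<open>f' : B \<rightarrow> B'\<close>).
\<close>

definition is_pushout :: "('o, 'm) precat \<Rightarrow> 'm \<Rightarrow> 'm \<Rightarrow> 'm \<Rightarrow> 'm \<Rightarrow> bool" where
  "is_pushout C i f i' f' \<longleftrightarrow>
     i \<in> Mor C \<and> f \<in> Mor C \<and> i' \<in> Mor C \<and> f' \<in> Mor C \<and>
     Dom C i = Dom C f \<and> Dom C i' = Cod C f \<and> Dom C f' = Cod C i \<and> Cod C i' = Cod C f' \<and>
     i' \<cdot>\<^bsub>C\<^esub> f = f' \<cdot>\<^bsub>C\<^esub> i \<and>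
     (\<forall>g \<in> Mor C. \<forall>h \<in> Mor C.
        Dom C g = Cod C f \<and> Dom C h = Cod C i \<and> Cod C g = Cod C h \<and> g \<cdot>\<^bsub>C\<^esub> f = h \<cdot>\<^bsub>C\<^esub> i \<longrightarrow>
        (\<exists>!u. u \<in> Hom C (Cod C i') (Cod C g) \<and> u \<cdot>\<^bsub>C\<^esub> i' = g \<and> u \<cdot>\<^bsub>C\<^esub> f' = h))"

text \<open>
  Zero objects and pushouts are determined only up to isomorphism, so \<open>R0\<close> is required for
  every zero object and \<open>R2\<close> for every choice of pushout.
\<close>

locale right_exact_category = additive_category C
  for C :: "('o, 'm) precat" (structure) +
  fixes Infl :: "'m set"
  assumes inflation_is_kernel: "i \<in> Infl \<Longrightarrow> is_kernel C i"
    and R0: "is_zero_object C Z \<Longrightarrow> Ident C Z \<in> Infl"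
    and R1: "\<lbrakk>i \<in> Infl; j \<in> Infl; Cod C i = Dom C j\<rbrakk> \<Longrightarrow> j \<cdot> i \<in> Infl"
    and R2_exists: "\<lbrakk>i \<in> Infl; f \<in> Mor C; Dom C f = Dom C i\<rbrakk> \<Longrightarrow> \<exists>i' f'. is_pushout C i f i' f'"
    and R2_stable: "\<lbrakk>i \<in> Infl; is_pushout C i f i' f'\<rbrakk> \<Longrightarrow> i' \<in> Infl"

locale strongly_right_exact_category = right_exact_category +
  assumes R3: "\<lbrakk>i \<in> Mor C; p \<in> Mor C; Cod C i = Dom C p; \<exists>c. is_cokernel_of C c i; p \<cdot> i \<in> Infl\<rbrakk>
    \<Longrightarrow> i \<in> Infl"

locale pre_abelian_category = additive_category +
  assumes kernel_exists: "f \<in> Mor C \<Longrightarrow> \<exists>k. is_kernel_of C k f"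
    and cokernel_exists: "f \<in> Mor C \<Longrightarrow> \<exists>c. is_cokernel_of C c f"

locale right_quasi_abelian_category = pre_abelian_category +
  assumes kernel_pushout: "\<lbrakk>is_kernel C k; is_pushout C k f k' f'\<rbrakk> \<Longrightarrow> is_kernel C k'"

locale additive_functor = source: additive_category D + target: additive_category C
  for D :: "('p, 'n) precat" and C :: "('o, 'm) precat" +
  fixes Lo :: "'p \<Rightarrow> 'o" and Lm :: "'n \<Rightarrow> 'm"
  assumes map_obj: "X \<in> Obj D \<Longrightarrow> Lo X \<in> Obj C"
    and map_Ident: "X \<in> Obj D \<Longrightarrow> Lm (Ident D X) = Ident C (Lo X)"
    and map_comp: "\<lbrakk>f \<in> Hom D X Y; g \<in> Hom D Y Z\<rbrakk> \<Longrightarrow> Lm (g \<cdot>\<^bsub>D\<^esub> f) = Lm g \<cdot>\<^bsub>C\<^esub> Lm f"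
    and map_hom: "\<lbrakk>X \<in> Obj D; Y \<in> Obj D\<rbrakk> \<Longrightarrow> Lm \<in> hom (Hom_group D X Y) (Hom_group C (Lo X) (Lo Y))"

definition preserves_cokernels ::
    "('p, 'n) precat \<Rightarrow> ('o, 'm) precat \<Rightarrow> ('n \<Rightarrow> 'm) \<Rightarrow> bool" where
  "preserves_cokernels D C Lm \<longleftrightarrow>
     (\<forall>c f. is_cokernel_of D c f \<longrightarrow> is_cokernel_of C (Lm c) (Lm f))"

end

theory Submission imports Defs begin

text \<open>
  In an additive category, a square is a pushout if and only if an associated pair of morphisms
  through a biproduct is a cokernel.  So \<open>L\<close>, being additive and cokernel preserving, preserves
  pushouts, which gives \<open>R2\<close>.  It remains to see that the kernels of a right quasi-abelian category
  satisfy \<open>R1\<close> and \<open>R3\<close>.  If \<open>i = ker f\<close> and \<open>j\<close> is a kernel, then \<open>j \<cdot> i\<close> is the kernel of the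
  pushout of \<open>f\<close> along \<open>j\<close>.  If \<open>p \<cdot> i\<close> is a kernel, let \<open>g'\<close> and \<open>i'\<close> be the pushouts of \<open>p \<cdot> i\<close>
  along \<open>i\<close> and of \<open>i\<close> along \<open>p \<cdot> i\<close>.  Then \<open>g'\<close> is a kernel, \<open>i'\<close> is split by the morphism
  induced by \<open>p\<close> and the identity, and so \<open>g' \<cdot> i = i' \<cdot> (p \<cdot> i)\<close> is a composite of kernels; as \<open>g'\<close>
  is monic, \<open>i\<close> is a kernel.
\<close>

section \<open>Kernels, cokernels and pushouts in terms of hom-sets\<close>

lemma HomD:
  assumes "f \<in> Hom C X Y"
  shows "f \<in> Mor C" "Dom C f = X" "Cod C f = Y"
  using assms by (auto simp: Hom_def)

text \<open>The \<open>Dom\<close> and \<open>Cod\<close> equations of the definition are traded for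
  membership in hom-sets, the form in which the category axioms take their premises; likewise for
  cokernels and pushouts below.\<close>

lemma is_kernel_of_iff:
  assumes "k \<in> Hom C A B" "f \<in> Hom C B E"
  shows "is_kernel_of C k f \<longleftrightarrow> f \<cdot>\<^bsub>C\<^esub> k = zero_mor C A E \<and>
    (\<forall>W g. g \<in> Hom C W B \<and> f \<cdot>\<^bsub>C\<^esub> g = zero_mor C W E \<longrightarrow>
      (\<exists>!u. u \<in> Hom C W A \<and> k \<cdot>\<^bsub>C\<^esub> u = g))"
  using HomD[OF assms(1)] HomD[OF assms(2)] unfolding is_kernel_of_def
  by (simp add: Hom_def Ball_def) blast

lemma is_cokernel_of_iff:
  assumes "c \<in> Hom C B E" "f \<in> Hom C A B"
  shows "is_cokernel_of C c f \<longleftrightarrow> c \<cdot>\<^bsub>C\<^esub> f = zero_mor C A E \<and>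
    (\<forall>W g. g \<in> Hom C B W \<and> g \<cdot>\<^bsub>C\<^esub> f = zero_mor C A W \<longrightarrow>
      (\<exists>!u. u \<in> Hom C E W \<and> u \<cdot>\<^bsub>C\<^esub> c = g))"
  using HomD[OF assms(1)] HomD[OF assms(2)] unfolding is_cokernel_of_def
  by (simp add: Hom_def Ball_def) blast

lemma is_pushout_iff:
  assumes "i \<in> Hom C A B" "f \<in> Hom C A A'" "i' \<in> Hom C A' P" "f' \<in> Hom C B P"
  shows "is_pushout C i f i' f' \<longleftrightarrow> i' \<cdot>\<^bsub>C\<^esub> f = f' \<cdot>\<^bsub>C\<^esub> i \<and>
    (\<forall>W g h. g \<in> Hom C A' W \<and> h \<in> Hom C B W \<and> g \<cdot>\<^bsub>C\<^esub> f = h \<cdot>\<^bsub>C\<^esub> i \<longrightarrow>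
      (\<exists>!u. u \<in> Hom C P W \<and> u \<cdot>\<^bsub>C\<^esub> i' = g \<and> u \<cdot>\<^bsub>C\<^esub> f' = h))"
proof -
  \<comment> \<open>\<open>R\<close> and \<open>U\<close> stay abstract, so that unfolding
    \<open>Hom\<close> affects only the typing of \<open>g\<close> and \<open>h\<close> and not the
    hom-set that contains the induced morphism.\<close>
  have *: "(\<forall>g \<in> Mor C. \<forall>h \<in> Mor C. Dom C g = A' \<and> Dom C h = B \<and> Cod C g = Cod C h \<and> R g h \<longrightarrow>
      U (Cod C g) g h) \<longleftrightarrow>
    (\<forall>W g h. g \<in> Hom C A' W \<and> h \<in> Hom C B W \<and> R g h \<longrightarrow> U W g h)" for R U
    unfolding Hom_def by (simp add: Ball_def) metis
  then show ?thesis
    unfolding is_pushout_def using assms[THEN HomD(1)] assms[THEN HomD(2)] assms[THEN HomD(3)]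
      *[of "\<lambda>g h. g \<cdot>\<^bsub>C\<^esub> f = h \<cdot>\<^bsub>C\<^esub> i"
        "\<lambda>W g h. \<exists>!u. u \<in> Hom C P W \<and> u \<cdot>\<^bsub>C\<^esub> i' = g \<and> u \<cdot>\<^bsub>C\<^esub> f' = h"]
    by simp
qed

lemma is_kernel_ofE:
  assumes "is_kernel_of C k f"
  obtains A B E where "k \<in> Hom C A B" "f \<in> Hom C B E"
  using assms unfolding is_kernel_of_def by (auto simp: Hom_def)

lemma is_pushoutE:
  assumes "is_pushout C i f i' f'"
  obtains A B A' P where "i \<in> Hom C A B" "f \<in> Hom C A A'" "i' \<in> Hom C A' P" "f' \<in> Hom C B P"
  using assms unfolding is_pushout_def by (auto simp: Hom_def)

context category
begin

lemma Hom_Obj: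
  assumes "f \<in> Hom C X Y"
  shows "X \<in> Obj C" "Y \<in> Obj C"
  using assms Dom_in Cod_in by (auto simp: Hom_def)

end

section \<open>Preadditive categories: zero morphisms, monomorphisms, pushout squares\<close>

context preadditive_category
begin

lemma zero_in: "\<lbrakk>X \<in> Obj C; Y \<in> Obj C\<rbrakk> \<Longrightarrow> zero_mor C X Y \<in> Hom C X Y"
  using Hom_comm_group[of X Y] monoid.one_closed[of "Hom_group C X Y"]
  by (simp add: Hom_group_def comm_group_def group_def)

lemma add_in:
  assumes "f \<in> Hom C X Y" "g \<in> Hom C X Y"
  shows "f \<boxplus> g \<in> Hom C X Y"
proof -
  interpret G: comm_group "Hom_group C X Y" using Hom_comm_group Hom_Obj[OF assms(1)] .
  show ?thesis using G.m_closed[of f g] assms by (simp add: Hom_group_def)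
qed

lemma zero_add:
  assumes "f \<in> Hom C X Y"
  shows "zero_mor C X Y \<boxplus> f = f"
proof -
  interpret G: comm_group "Hom_group C X Y" using Hom_comm_group Hom_Obj[OF assms(1)] .
  show ?thesis using G.l_one[of f] assms by (simp add: Hom_group_def)
qed

lemma add_zero:
  assumes "f \<in> Hom C X Y"
  shows "f \<boxplus> zero_mor C X Y = f"
proof -
  interpret G: comm_group "Hom_group C X Y" using Hom_comm_group Hom_Obj[OF assms(1)] .
  show ?thesis using G.r_one[of f] assms by (simp add: Hom_group_def)
qed

lemma add_right_cancel:
  assumes "f \<in> Hom C X Y" "g \<in> Hom C X Y" "h \<in> Hom C X Y"
  shows "f \<boxplus> h = g \<boxplus> h \<longleftrightarrow> f = g"
proof -
  interpret G: comm_group "Hom_group C X Y" using Hom_comm_group Hom_Obj[OF assms(1)] .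
  show ?thesis using G.right_cancel[of h f g] assms by (auto simp: Hom_group_def)
qed

lemma neg_exists:
  assumes "f \<in> Hom C X Y"
  obtains n where "n \<in> Hom C X Y" "f \<boxplus> n = zero_mor C X Y"
proof -
  interpret G: comm_group "Hom_group C X Y" using Hom_comm_group Hom_Obj[OF assms(1)] .
  show ?thesis using G.inv_closed[of f] G.r_inv[of f] assms that by (simp add: Hom_group_def)
qed

text \<open>By distributivity the composite added to itself is again the composite; cancelling in
  the hom-group leaves zero.\<close>

lemma zero_comp:
  assumes "f \<in> Hom C X Y" "Z \<in> Obj C"
  shows "zero_mor C Y Z \<cdot> f = zero_mor C X Z"
proof -
  have z: "zero_mor C Y Z \<in> Hom C Y Z" "zero_mor C X Z \<in> Hom C X Z"
    using zero_in Hom_Obj[OF assms(1)] assms(2) by auto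
  have zf: "zero_mor C Y Z \<cdot> f \<in> Hom C X Z" using comp_in assms(1) z(1) .
  have "(zero_mor C Y Z \<cdot> f) \<boxplus> (zero_mor C Y Z \<cdot> f) = zero_mor C X Z \<boxplus> (zero_mor C Y Z \<cdot> f)"
    using comp_add_left[OF assms(1) z(1) z(1)] zero_add[OF z(1)] zero_add[OF zf] by simp
  then show ?thesis using add_right_cancel zf z(2) by blast
qed

lemma comp_zero:
  assumes "f \<in> Hom C Y Z" "X \<in> Obj C"
  shows "f \<cdot> zero_mor C X Y = zero_mor C X Z"
proof -
  have z: "zero_mor C X Y \<in> Hom C X Y" "zero_mor C X Z \<in> Hom C X Z"
    using zero_in Hom_Obj[OF assms(1)] assms(2) by auto
  have fz: "f \<cdot> zero_mor C X Y \<in> Hom C X Z" using comp_in z(1) assms(1) .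
  have "(f \<cdot> zero_mor C X Y) \<boxplus> (f \<cdot> zero_mor C X Y) = zero_mor C X Z \<boxplus> (f \<cdot> zero_mor C X Y)"
    using comp_add_right[OF z(1) z(1) assms(1)] zero_add[OF z(1)] zero_add[OF fz] by simp
  then show ?thesis using add_right_cancel fz z(2) by blast
qed

text \<open>In this equational form being a zero object visibly passes through an additive functor.
  If the identity of \<open>Z\<close> is zero, composing with it shows that every morphism into or
  out of \<open>Z\<close> is zero.\<close>

lemma zero_object_iff:
  "is_zero_object C Z \<longleftrightarrow> Z \<in> Obj C \<and> Ident C Z = zero_mor C Z Z"
proof
  assume "is_zero_object C Z"
  then show "Z \<in> Obj C \<and> Ident C Z = zero_mor C Z Z"
    unfolding is_zero_object_def using Ident_in[of Z] zero_in[of Z Z] by auto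
next
  assume Z: "Z \<in> Obj C \<and> Ident C Z = zero_mor C Z Z"
  have "f = zero_mor C X Z" if "X \<in> Obj C" "f \<in> Hom C X Z" for X f
    using Ident_comp[OF that(2)] zero_comp[OF that(2)] Z by metis
  moreover have "f = zero_mor C Z X" if "X \<in> Obj C" "f \<in> Hom C Z X" for X f
    using comp_Ident[OF that(2)] comp_zero[OF that(2)] Z by metis
  ultimately show "is_zero_object C Z"
    unfolding is_zero_object_def using zero_in Z by metis
qed

text \<open>Both \<open>u\<close> and \<open>v\<close> factor the one morphism
  \<open>k \<cdot> u\<close>, which the map with kernel \<open>k\<close> kills, and factorizations
  through a kernel are unique.\<close>

lemma kernel_monic:
  assumes "is_kernel C k" "k \<in> Hom C A B" "u \<in> Hom C W A" "v \<in> Hom C W A" "k \<cdot> u = k \<cdot> v"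
  shows "u = v"
proof -
  obtain f where f: "is_kernel_of C k f" using assms(1) unfolding is_kernel_def by blast
  obtain E where fE: "f \<in> Hom C B E"
    using f assms(2) by (auto elim!: is_kernel_ofE simp: Hom_def)
  note K = f[unfolded is_kernel_of_iff[OF assms(2) fE]]
  have "f \<cdot> (k \<cdot> u) = zero_mor C A E \<cdot> u"
    using comp_assoc[OF assms(3) assms(2) fE] K by simp
  also have "\<dots> = zero_mor C W E" using zero_comp assms(3) Hom_Obj[OF fE] by blast
  finally show ?thesis using K comp_in[OF assms(3) assms(2)] assms(3-5) by metis
qed

text \<open>\<open>i\<close> is the kernel of \<open>1 - i \<cdot> u\<close>: that morphism kills
  \<open>h\<close> exactly when \<open>h = i \<cdot> (u \<cdot> h)\<close>, so
  \<open>u \<cdot> h\<close> is the factorization.\<close>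

lemma split_mono_is_kernel:
  assumes i: "i \<in> Hom C A B" and u: "u \<in> Hom C B A" and ui: "u \<cdot> i = Ident C A"
  shows "is_kernel C i"
proof -
  note iu = comp_in[OF u i]
  obtain n where n: "n \<in> Hom C B B" "(i \<cdot> u) \<boxplus> n = zero_mor C B B" using neg_exists[OF iu] .
  \<comment> \<open>\<open>n\<close> is the negative of \<open>i \<cdot> u\<close>, so this is
    \<open>1 - i \<cdot> u\<close>.\<close>
  define w where "w = Ident C B \<boxplus> n"
  have I: "Ident C B \<in> Hom C B B" using Ident_in Hom_Obj[OF i] by blast
  have w: "w \<in> Hom C B B" unfolding w_def using add_in I n(1) by blast
  have w_comp: "w \<cdot> h = h \<boxplus> (n \<cdot> h)" "((i \<cdot> u) \<cdot> h) \<boxplus> (n \<cdot> h) = zero_mor C W B"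
    if "h \<in> Hom C W B" for W h
    using comp_add_left[OF that I n(1)] Ident_comp[OF that] comp_add_left[OF that iu n(1)]
      zero_comp[OF that, of B] Hom_Obj[OF i] n(2) by (auto simp: w_def)
  have iui: "(i \<cdot> u) \<cdot> i = i" using comp_assoc[OF i u i] ui comp_Ident[OF i] by simp
  have "is_kernel_of C i w"
    unfolding is_kernel_of_iff[OF i w]
  proof (intro conjI allI impI)
    show "w \<cdot> i = zero_mor C A B" using w_comp[OF i] iui by simp
    fix W h assume h: "h \<in> Hom C W B \<and> w \<cdot> h = zero_mor C W B"
    then have hB: "h \<in> Hom C W B" by blast
    have "h = (i \<cdot> u) \<cdot> h"
      using w_comp[OF hB] h add_right_cancel[OF hB comp_in[OF hB iu] comp_in[OF hB n(1)]] by simp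
    then have ex: "i \<cdot> (u \<cdot> h) = h" using comp_assoc[OF hB u i] by simp
    have unique: "v = u \<cdot> h" if "v \<in> Hom C W A" "i \<cdot> v = h" for v
      using comp_assoc[OF that(1) i u] ui Ident_comp[OF that(1)] that(2) by simp
    show "\<exists>!v. v \<in> Hom C W A \<and> i \<cdot> v = h" using ex unique comp_in[OF hB u] by blast
  qed
  then show ?thesis unfolding is_kernel_def by blast
qed

text \<open>
  The usual pair \<open>(f, -i)\<close> into the biproduct, where \<open>n\<close> stands for \<open>-i\<close>; stated this way, the
  hypotheses on \<open>n\<close> are visibly preserved by additive functors.
\<close>

lemma pushout_iff_cokernel:
  assumes i: "i \<in> Hom C A B" and f: "f \<in> Hom C A A'"
    and i': "i' \<in> Hom C A' P" and f': "f' \<in> Hom C B P"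
    and n: "n \<in> Hom C A B" "i \<boxplus> n = zero_mor C A B"
    and S: "is_biproduct C A' B S i1 i2 p1 p2"
  shows "is_pushout C i f i' f' \<longleftrightarrow>
    is_cokernel_of C ((i' \<cdot> p1) \<boxplus> (f' \<cdot> p2)) ((i1 \<cdot> f) \<boxplus> (i2 \<cdot> n))"
proof -
  have i1: "i1 \<in> Hom C A' S" and i2: "i2 \<in> Hom C B S" and p1: "p1 \<in> Hom C S A'"
    and p2: "p2 \<in> Hom C S B" and p1i1: "p1 \<cdot> i1 = Ident C A'" and p2i2: "p2 \<cdot> i2 = Ident C B"
    and p2i1: "p2 \<cdot> i1 = zero_mor C A' B" and p1i2: "p1 \<cdot> i2 = zero_mor C B A'"
    and idS: "(i1 \<cdot> p1) \<boxplus> (i2 \<cdot> p2) = Ident C S"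
    using S unfolding is_biproduct_def by auto
  define d where "d = (i1 \<cdot> f) \<boxplus> (i2 \<cdot> n)"
  \<comment> \<open>The morphism out of \<open>S\<close> that restricts to \<open>g\<close> on
    \<open>A'\<close> and to \<open>h\<close> on \<open>B\<close>, as \<open>copair1\<close> and
    \<open>copair2\<close> confirm.\<close>
  define copair where "copair g h = (g \<cdot> p1) \<boxplus> (h \<cdot> p2)" for g h
  note O = Hom_Obj[OF i] Hom_Obj[OF f]
  have d: "d \<in> Hom C A S" unfolding d_def by (intro add_in comp_in[OF f i1] comp_in[OF n(1) i2])
  have copair_in: "copair g h \<in> Hom C S W" if "g \<in> Hom C A' W" "h \<in> Hom C B W" for g h W
    unfolding copair_def using add_in comp_in[OF p1 that(1)] comp_in[OF p2 that(2)] by blast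
  have copair1: "copair g h \<cdot> i1 = g" if g: "g \<in> Hom C A' W" and h: "h \<in> Hom C B W" for g h W
    unfolding copair_def comp_add_left[OF i1 comp_in[OF p1 g] comp_in[OF p2 h]]
    using comp_assoc[OF i1 p1 g] comp_assoc[OF i1 p2 h] p1i1 p2i1 comp_Ident[OF g]
      comp_zero[OF h] add_zero[OF g] O by simp
  have copair2: "copair g h \<cdot> i2 = h" if g: "g \<in> Hom C A' W" and h: "h \<in> Hom C B W" for g h W
    unfolding copair_def comp_add_left[OF i2 comp_in[OF p1 g] comp_in[OF p2 h]]
    using comp_assoc[OF i2 p1 g] comp_assoc[OF i2 p2 h] p1i2 p2i2 comp_Ident[OF h]
      comp_zero[OF g] zero_add[OF h] O by simp
  have copair_eta: "copair (g \<cdot> i1) (g \<cdot> i2) = g" if g: "g \<in> Hom C S W" for g W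
    unfolding copair_def
    using comp_assoc[OF p1 i1 g] comp_assoc[OF p2 i2 g] idS comp_Ident[OF g]
      comp_add_right[OF comp_in[OF p1 i1] comp_in[OF p2 i2] g] by simp
  have comp_copair: "u \<cdot> copair g h = copair (u \<cdot> g) (u \<cdot> h)"
    if g: "g \<in> Hom C A' W" and h: "h \<in> Hom C B W" and u: "u \<in> Hom C W V" for u g h W V
    unfolding copair_def
    using comp_add_right[OF comp_in[OF p1 g] comp_in[OF p2 h] u]
      comp_assoc[OF p1 g u] comp_assoc[OF p2 h u] by simp
  \<comment> \<open>The composite is \<open>g \<cdot> f - h \<cdot> i\<close>, so morphisms out of
    \<open>S\<close> that kill \<open>d\<close> are the same as cocones on the span of
    \<open>f\<close> and \<open>i\<close>.\<close>
  have copair_d: "copair g h \<cdot> d = zero_mor C A W \<longleftrightarrow> g \<cdot> f = h \<cdot> i"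
    if g: "g \<in> Hom C A' W" and h: "h \<in> Hom C B W" for g h W
  proof -
    note gh = copair_in[OF g h]
    have "copair g h \<cdot> d = (g \<cdot> f) \<boxplus> (h \<cdot> n)"
      unfolding d_def
      using comp_add_right[OF comp_in[OF f i1] comp_in[OF n(1) i2] gh]
        comp_assoc[OF f i1 gh] comp_assoc[OF n(1) i2 gh] copair1[OF g h] copair2[OF g h] by simp
    moreover have "(h \<cdot> i) \<boxplus> (h \<cdot> n) = zero_mor C A W"
      using comp_add_right[OF i n(1) h] n(2) comp_zero[OF h] O by simp
    ultimately show ?thesis
      using add_right_cancel[OF comp_in[OF f g] comp_in[OF i h] comp_in[OF n(1) h]] by simp
  qed
  note c = copair_in[OF i' f']
  \<comment> \<open>A morphism out of the biproduct is determined by its two restrictions, so both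
    universal properties ask for the same \<open>u\<close>.\<close>
  have univ: "u \<in> Hom C P W \<and> u \<cdot> copair i' f' = copair g h \<longleftrightarrow>
      u \<in> Hom C P W \<and> u \<cdot> i' = g \<and> u \<cdot> f' = h"
    if g: "g \<in> Hom C A' W" and h: "h \<in> Hom C B W" for u g h W
    using comp_copair[OF i' f'] copair1[OF g h] copair2[OF g h]
      copair1[OF comp_in[OF i'] comp_in[OF f']] copair2[OF comp_in[OF i'] comp_in[OF f']]
    by metis
  have "is_pushout C i f i' f' \<longleftrightarrow> is_cokernel_of C (copair i' f') d"
    unfolding is_pushout_iff[OF i f i' f'] is_cokernel_of_iff[OF c d] copair_d[OF i' f']
  proof (intro conj_cong refl iffI allI impI)
    fix W g
    assume *: "\<forall>W g h. g \<in> Hom C A' W \<and> h \<in> Hom C B W \<and> g \<cdot> f = h \<cdot> i \<longrightarrow>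
        (\<exists>!u. u \<in> Hom C P W \<and> u \<cdot> i' = g \<and> u \<cdot> f' = h)"
      and g: "g \<in> Hom C S W \<and> g \<cdot> d = zero_mor C A W"
    have gi: "g \<cdot> i1 \<in> Hom C A' W" "g \<cdot> i2 \<in> Hom C B W" using g comp_in i1 i2 by blast+
    have "(g \<cdot> i1) \<cdot> f = (g \<cdot> i2) \<cdot> i" using copair_d[OF gi] copair_eta g by metis
    then have "\<exists>!u. u \<in> Hom C P W \<and> u \<cdot> i' = g \<cdot> i1 \<and> u \<cdot> f' = g \<cdot> i2" using * gi by blast
    then show "\<exists>!u. u \<in> Hom C P W \<and> u \<cdot> copair i' f' = g"
      unfolding univ[OF gi, symmetric] using copair_eta g by metis
  next
    fix W g h
    assume *: "\<forall>W g. g \<in> Hom C S W \<and> g \<cdot> d = zero_mor C A W \<longrightarrow>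
        (\<exists>!u. u \<in> Hom C P W \<and> u \<cdot> copair i' f' = g)"
      and gh: "g \<in> Hom C A' W \<and> h \<in> Hom C B W \<and> g \<cdot> f = h \<cdot> i"
    then have g: "g \<in> Hom C A' W" and h: "h \<in> Hom C B W" by auto
    show "\<exists>!u. u \<in> Hom C P W \<and> u \<cdot> i' = g \<and> u \<cdot> f' = h"
      unfolding univ[OF g h, symmetric] using * copair_in[OF g h] copair_d[OF g h] gh by blast
  qed
  then show ?thesis by (simp add: copair_def d_def)
qed

end

section \<open>Existence of pushouts\<close>

context pre_abelian_category
begin

text \<open>The pushout is read off from a cokernel of the pair \<open>(f, -i)\<close>, by
  restricting it to the two summands.\<close>

lemma pushout_exists:
  assumes i: "i \<in> Hom C A B" and f: "f \<in> Hom C A A'"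
  obtains P i' f' where "i' \<in> Hom C A' P" "f' \<in> Hom C B P" "is_pushout C i f i' f'"
proof -
  obtain n where n: "n \<in> Hom C A B" "i \<boxplus> n = zero_mor C A B" using neg_exists[OF i] .
  obtain S i1 i2 p1 p2 where S: "is_biproduct C A' B S i1 i2 p1 p2"
    using biproduct_exists Hom_Obj[OF i] Hom_Obj[OF f] by metis
  then have i1: "i1 \<in> Hom C A' S" and i2: "i2 \<in> Hom C B S" and p1: "p1 \<in> Hom C S A'"
    and p2: "p2 \<in> Hom C S B" and idS: "(i1 \<cdot> p1) \<boxplus> (i2 \<cdot> p2) = Ident C S"
    unfolding is_biproduct_def by auto
  have d: "(i1 \<cdot> f) \<boxplus> (i2 \<cdot> n) \<in> Hom C A S"
    by (intro add_in comp_in[OF f i1] comp_in[OF n(1) i2])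
  obtain c where c: "is_cokernel_of C c ((i1 \<cdot> f) \<boxplus> (i2 \<cdot> n))"
    using cokernel_exists HomD[OF d] by blast
  define P where "P = Cod C c"
  have cP: "c \<in> Hom C S P" using c d by (auto simp: is_cokernel_of_def Hom_def P_def)
  \<comment> \<open>The cokernel is the copairing of its restrictions, the shape required by
    \<open>pushout_iff_cokernel\<close>.\<close>
  have "((c \<cdot> i1) \<cdot> p1) \<boxplus> ((c \<cdot> i2) \<cdot> p2) = c"
    using comp_assoc[OF p1 i1 cP] comp_assoc[OF p2 i2 cP] idS comp_Ident[OF cP]
      comp_add_right[OF comp_in[OF p1 i1] comp_in[OF p2 i2] cP] by simp
  then have "is_pushout C i f (c \<cdot> i1) (c \<cdot> i2)"
    using pushout_iff_cokernel[OF i f comp_in[OF i1 cP] comp_in[OF i2 cP] n S] c by simp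
  then show ?thesis using that comp_in[OF i1 cP] comp_in[OF i2 cP] by blast
qed

end

section \<open>Kernels in right quasi-abelian categories\<close>

context right_quasi_abelian_category
begin

text \<open>A morphism killed by the pushout \<open>f'\<close> of \<open>f\<close> is killed by
  \<open>d\<close> as well, so it equals \<open>j \<cdot> h\<close> for some \<open>h\<close>. Since
  \<open>j'\<close> is monic, \<open>f \<cdot> h\<close> is zero, and \<open>h\<close> factors
  through \<open>i\<close>.\<close>

lemma kernel_comp:
  assumes i: "is_kernel C i" and j: "is_kernel C j" and ij: "Cod C i = Dom C j"
  shows "is_kernel C (j \<cdot> i)"
proof -
  obtain f where f: "is_kernel_of C i f" using i unfolding is_kernel_def by blast
  obtain A B Q where iA: "i \<in> Hom C A B" and fB: "f \<in> Hom C B Q" using f is_kernel_ofE by metis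
  obtain d where d: "is_kernel_of C j d" using j unfolding is_kernel_def by blast
  obtain E F where jE: "j \<in> Hom C B E" and dE: "d \<in> Hom C E F"
    using d ij HomD[OF iA] is_kernel_ofE HomD(2) by metis
  obtain P j' f' where j': "j' \<in> Hom C Q P" and f': "f' \<in> Hom C E P"
    and po: "is_pushout C j f j' f'" using pushout_exists[OF jE fB] .
  note PO = po[unfolded is_pushout_iff[OF jE fB j' f']]
  note Ki = f[unfolded is_kernel_of_iff[OF iA fB]]
  note Kj = d[unfolded is_kernel_of_iff[OF jE dE]]
  have O: "A \<in> Obj C" "B \<in> Obj C" "Q \<in> Obj C" "E \<in> Obj C" "F \<in> Obj C" "P \<in> Obj C"
    using Hom_Obj[OF iA] Hom_Obj[OF fB] Hom_Obj[OF dE] Hom_Obj[OF j'] by auto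
  have square: "f' \<cdot> (j \<cdot> h) = j' \<cdot> (f \<cdot> h)" if "h \<in> Hom C W B" for W h
    using comp_assoc[OF that jE f'] comp_assoc[OF that fB j'] PO by simp
  \<comment> \<open>The zero morphism on \<open>Q\<close> and \<open>d\<close> on \<open>E\<close>
    agree on \<open>B\<close>, so they induce \<open>u\<close>; hence whatever \<open>f'\<close>
    kills is killed by \<open>d\<close>.\<close>
  obtain u where u: "u \<in> Hom C P F" "u \<cdot> f' = d"
  proof -
    have "zero_mor C Q F \<cdot> f = d \<cdot> j" using Kj zero_comp[OF fB] O by simp
    then show ?thesis using PO zero_in O dE that by metis
  qed
  have "is_kernel_of C (j \<cdot> i) f'"
    unfolding is_kernel_of_iff[OF comp_in[OF iA jE] f']
  proof (intro conjI allI impI)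
    show "f' \<cdot> (j \<cdot> i) = zero_mor C A P" using square[OF iA] Ki comp_zero[OF j'] O by simp
    fix W g assume "g \<in> Hom C W E \<and> f' \<cdot> g = zero_mor C W P"
    then have g: "g \<in> Hom C W E" and f'g: "f' \<cdot> g = zero_mor C W P" by auto
    have W: "W \<in> Obj C" using Hom_Obj[OF g] by blast
    have "d \<cdot> g = zero_mor C W F"
      using comp_assoc[OF g f' u(1)] u(2) f'g comp_zero[OF u(1) W] by simp
    then obtain h where h: "h \<in> Hom C W B" "j \<cdot> h = g" using Kj g by blast
    have "j' \<cdot> (f \<cdot> h) = j' \<cdot> zero_mor C W Q"
      using square[OF h(1)] h(2) f'g comp_zero[OF j' W] by simp
    \<comment> \<open>Here stability of kernels under pushout enters: \<open>j'\<close> is a kernel,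
      hence monic.\<close>
    then have "f \<cdot> h = zero_mor C W Q"
      using kernel_monic[OF kernel_pushout[OF j po] j'] comp_in[OF h(1) fB] zero_in O W by blast
    then obtain v where v: "v \<in> Hom C W A" "i \<cdot> v = h" using Ki h by blast
    have "(j \<cdot> i) \<cdot> v = g" using comp_assoc[OF v(1) iA jE] v h by simp
    moreover have "v' = v" if v': "v' \<in> Hom C W A" "(j \<cdot> i) \<cdot> v' = g" for v'
    proof -
      have "j \<cdot> (i \<cdot> v') = j \<cdot> h" using comp_assoc[OF v'(1) iA jE] v' h by simp
      then have "i \<cdot> v' = i \<cdot> v" using kernel_monic[OF j jE comp_in[OF v'(1) iA] h(1)] v by simp
      then show ?thesis using kernel_monic[OF i iA v'(1) v(1)] by blast
    qed
    ultimately show "\<exists>!v. v \<in> Hom C W A \<and> (j \<cdot> i) \<cdot> v = g" using v(1) by blast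
  qed
  then show ?thesis unfolding is_kernel_def by blast
qed

text \<open>This is R3 for the class of all kernels.\<close>

lemma kernel_if_comp_kernel:
  assumes i: "i \<in> Hom C A B" and p: "p \<in> Hom C B E" and pi: "is_kernel C (p \<cdot> i)"
  shows "is_kernel C i"
proof -
  define g where "g = p \<cdot> i"
  have g: "g \<in> Hom C A E" unfolding g_def using comp_in[OF i p] .
  have kg: "is_kernel C g" unfolding g_def using pi .
  obtain P g' i' where g': "g' \<in> Hom C B P" and i': "i' \<in> Hom C E P"
    and po: "is_pushout C g i g' i'" using pushout_exists[OF g i] .
  note PO = po[unfolded is_pushout_iff[OF g i g' i']]
  have I: "Ident C E \<in> Hom C E E" using Ident_in Hom_Obj[OF p] by blast
  \<comment> \<open>\<open>p\<close> and the identity of \<open>E\<close> form a cocone on the span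
    of \<open>i\<close> and \<open>g\<close>; the induced \<open>u\<close> is a retraction of
    \<open>i'\<close>.\<close>
  have "p \<cdot> i = Ident C E \<cdot> g" using Ident_comp[OF g] g_def by simp
  then obtain u where u: "u \<in> Hom C P E" "u \<cdot> i' = Ident C E" using PO p I by metis
  have kg': "is_kernel C g'" using kernel_pushout[OF kg po] .
  \<comment> \<open>By commutativity of the pushout square this composite is
    \<open>g' \<cdot> i\<close>.\<close>
  have "is_kernel C (i' \<cdot> g)"
    using kernel_comp[OF kg split_mono_is_kernel[OF i' u]] HomD[OF g] HomD[OF i'] by simp
  then obtain d where d: "is_kernel_of C (g' \<cdot> i) d" using PO unfolding is_kernel_def by auto
  obtain F where dF: "d \<in> Hom C P F"
    using d comp_in[OF i g'] by (auto elim!: is_kernel_ofE simp: Hom_def)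
  note K = d[unfolded is_kernel_of_iff[OF comp_in[OF i g'] dF]]
  \<comment> \<open>As \<open>g'\<close> is monic, factoring \<open>h\<close> through
    \<open>i\<close> amounts to factoring \<open>g' \<cdot> h\<close> through
    \<open>g' \<cdot> i\<close>, the kernel of \<open>d\<close>.\<close>
  have "is_kernel_of C i (d \<cdot> g')"
    unfolding is_kernel_of_iff[OF i comp_in[OF g' dF]]
  proof (intro conjI allI impI)
    show "(d \<cdot> g') \<cdot> i = zero_mor C A F" using comp_assoc[OF i g' dF] K by simp
    fix W h assume "h \<in> Hom C W B \<and> (d \<cdot> g') \<cdot> h = zero_mor C W F"
    then have h: "h \<in> Hom C W B" "d \<cdot> (g' \<cdot> h) = zero_mor C W F"
      using comp_assoc[OF _ g' dF] by auto
    have "(g' \<cdot> i) \<cdot> v = g' \<cdot> h \<longleftrightarrow> i \<cdot> v = h" if v: "v \<in> Hom C W A" for v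
      using comp_assoc[OF v i g'] kernel_monic[OF kg' g' comp_in[OF v i] h(1)] by auto
    moreover have "\<exists>!v. v \<in> Hom C W A \<and> (g' \<cdot> i) \<cdot> v = g' \<cdot> h"
      using K h(2) comp_in[OF h(1) g'] by blast
    ultimately show "\<exists>!v. v \<in> Hom C W A \<and> i \<cdot> v = h" by metis
  qed
  then show ?thesis unfolding is_kernel_def by blast
qed

end

section \<open>Additive functors and pushouts\<close>

context additive_functor
begin

lemma map_in: "f \<in> Hom D X Y \<Longrightarrow> Lm f \<in> Hom C (Lo X) (Lo Y)"
  using map_hom[of X Y] source.Hom_Obj[of f X Y] by (auto simp: hom_def Hom_group_def)

lemma map_add:
  "\<lbrakk>f \<in> Hom D X Y; g \<in> Hom D X Y\<rbrakk> \<Longrightarrow> Lm (f \<boxplus>\<^bsub>D\<^esub> g) = Lm f \<boxplus>\<^bsub>C\<^esub> Lm g"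
  using map_hom[of X Y] source.Hom_Obj[of f X Y] by (auto simp: hom_def Hom_group_def)

lemma map_zero:
  assumes "X \<in> Obj D" "Y \<in> Obj D"
  shows "Lm (zero_mor D X Y) = zero_mor C (Lo X) (Lo Y)"
proof -
  note z = source.zero_in[OF assms] and z' = target.zero_in[OF map_obj map_obj, OF assms]
  have "Lm (zero_mor D X Y) \<boxplus>\<^bsub>C\<^esub> Lm (zero_mor D X Y) =
      zero_mor C (Lo X) (Lo Y) \<boxplus>\<^bsub>C\<^esub> Lm (zero_mor D X Y)"
    using map_add[OF z z] source.zero_add[OF z] target.zero_add[OF map_in[OF z]] by simp
  then show ?thesis using target.add_right_cancel map_in[OF z] z' by blast
qed

text \<open>Biproducts are given by equations between composites, sums, identities and zero
  morphisms, all of which an additive functor respects.\<close>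

lemma map_biproduct:
  assumes "is_biproduct D X Y S i1 i2 p1 p2"
  shows "is_biproduct C (Lo X) (Lo Y) (Lo S) (Lm i1) (Lm i2) (Lm p1) (Lm p2)"
proof -
  have h: "i1 \<in> Hom D X S" "i2 \<in> Hom D Y S" "p1 \<in> Hom D S X" "p2 \<in> Hom D S Y"
    and e: "p1 \<cdot>\<^bsub>D\<^esub> i1 = Ident D X" "p2 \<cdot>\<^bsub>D\<^esub> i2 = Ident D Y"
      "p2 \<cdot>\<^bsub>D\<^esub> i1 = zero_mor D X Y" "p1 \<cdot>\<^bsub>D\<^esub> i2 = zero_mor D Y X"
      "(i1 \<cdot>\<^bsub>D\<^esub> p1) \<boxplus>\<^bsub>D\<^esub> (i2 \<cdot>\<^bsub>D\<^esub> p2) = Ident D S"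
    using assms unfolding is_biproduct_def by auto
  have O: "X \<in> Obj D" "Y \<in> Obj D" "S \<in> Obj D"
    using source.Hom_Obj[OF h(1)] source.Hom_Obj[OF h(2)] by auto
  have sum: "(Lm i1 \<cdot>\<^bsub>C\<^esub> Lm p1) \<boxplus>\<^bsub>C\<^esub> (Lm i2 \<cdot>\<^bsub>C\<^esub> Lm p2) = Ident C (Lo S)"
    using map_add[OF source.comp_in[OF h(3) h(1)] source.comp_in[OF h(4) h(2)]] e(5)
      map_comp[OF h(3) h(1)] map_comp[OF h(4) h(2)] map_Ident[OF O(3)] by simp
  show ?thesis unfolding is_biproduct_def
    using h[THEN map_in] map_comp[OF h(1) h(3)] map_comp[OF h(2) h(4)] map_comp[OF h(1) h(4)]
      map_comp[OF h(2) h(3)] e map_Ident map_zero O sum by simp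
qed

lemma map_zero_object: "is_zero_object D Z \<Longrightarrow> is_zero_object C (Lo Z)"
  unfolding source.zero_object_iff target.zero_object_iff
  using map_obj map_Ident map_zero by metis

text \<open>A biproduct turns the square into a cokernel in \<open>D\<close>; the functor preserves
  this cokernel, and the image biproduct turns it back into a pushout in \<open>C\<close>.\<close>

lemma map_pushout:
  assumes L: "preserves_cokernels D C Lm" and po: "is_pushout D i f i' f'"
  shows "is_pushout C (Lm i) (Lm f) (Lm i') (Lm f')"
proof -
  obtain A B A' P where i: "i \<in> Hom D A B" and f: "f \<in> Hom D A A'"
    and i': "i' \<in> Hom D A' P" and f': "f' \<in> Hom D B P" using is_pushoutE[OF po] .
  obtain n where n: "n \<in> Hom D A B" "i \<boxplus>\<^bsub>D\<^esub> n = zero_mor D A B" using source.neg_exists[OF i] .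
  obtain S i1 i2 p1 p2 where S: "is_biproduct D A' B S i1 i2 p1 p2"
    using source.biproduct_exists source.Hom_Obj[OF i] source.Hom_Obj[OF f] by metis
  then have h: "i1 \<in> Hom D A' S" "i2 \<in> Hom D B S" "p1 \<in> Hom D S A'" "p2 \<in> Hom D S B"
    unfolding is_biproduct_def by auto
  have Ln: "Lm i \<boxplus>\<^bsub>C\<^esub> Lm n = zero_mor C (Lo A) (Lo B)"
    using map_add[OF i n(1)] n(2) map_zero source.Hom_Obj[OF i] by simp
  have "is_cokernel_of C (Lm ((i' \<cdot>\<^bsub>D\<^esub> p1) \<boxplus>\<^bsub>D\<^esub> (f' \<cdot>\<^bsub>D\<^esub> p2)))
      (Lm ((i1 \<cdot>\<^bsub>D\<^esub> f) \<boxplus>\<^bsub>D\<^esub> (i2 \<cdot>\<^bsub>D\<^esub> n)))"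
    using L po source.pushout_iff_cokernel[OF i f i' f' n S]
    unfolding preserves_cokernels_def by blast
  moreover have "Lm ((i' \<cdot>\<^bsub>D\<^esub> p1) \<boxplus>\<^bsub>D\<^esub> (f' \<cdot>\<^bsub>D\<^esub> p2)) =
      (Lm i' \<cdot>\<^bsub>C\<^esub> Lm p1) \<boxplus>\<^bsub>C\<^esub> (Lm f' \<cdot>\<^bsub>C\<^esub> Lm p2)"
    using map_add[OF source.comp_in[OF h(3) i'] source.comp_in[OF h(4) f']]
      map_comp[OF h(3) i'] map_comp[OF h(4) f'] by simp
  moreover have "Lm ((i1 \<cdot>\<^bsub>D\<^esub> f) \<boxplus>\<^bsub>D\<^esub> (i2 \<cdot>\<^bsub>D\<^esub> n)) =
      (Lm i1 \<cdot>\<^bsub>C\<^esub> Lm f) \<boxplus>\<^bsub>C\<^esub> (Lm i2 \<cdot>\<^bsub>C\<^esub> Lm n)"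
    using map_add[OF source.comp_in[OF f h(1)] source.comp_in[OF n(1) h(2)]]
      map_comp[OF f h(1)] map_comp[OF n(1) h(2)] by simp
  ultimately show ?thesis
    using target.pushout_iff_cokernel[OF map_in[OF i] map_in[OF f] map_in[OF i'] map_in[OF f']
        map_in[OF n(1)] Ln map_biproduct[OF S]] by simp
qed

end

section \<open>The induced structure\<close>

lemma induced_right_exact:
  assumes "right_quasi_abelian_category D" and "additive_functor D C Lo Lm"
    and L: "preserves_cokernels D C Lm" and "right_exact_category C Infl"
  shows "right_exact_category D {j. is_kernel D j \<and> Lm j \<in> Infl}"
proof -
  interpret D: right_quasi_abelian_category D by fact
  interpret additive_functor D C Lo Lm by fact
  interpret E: right_exact_category C Infl by fact
  show ?thesis
  proof (unfold_locales, goal_cases)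
    case (1 i)
    then show ?case by blast
  next
    case (2 Z)
    then have Z: "Z \<in> Obj D" by (simp add: is_zero_object_def)
    \<comment> \<open>An identity is its own retraction, hence a split monomorphism.\<close>
    then have "is_kernel D (Ident D Z)"
      using D.split_mono_is_kernel D.Ident_in D.comp_Ident by blast
    then show ?case using E.R0[OF map_zero_object[OF 2]] map_Ident[OF Z] by simp
  next
    case (3 i j)
    then have ij: "i \<in> Hom D (Dom D i) (Dom D j)" "j \<in> Hom D (Dom D j) (Cod D j)"
      by (auto simp: is_kernel_def is_kernel_of_def Hom_def)
    have "Lm j \<cdot>\<^bsub>C\<^esub> Lm i \<in> Infl"
      using E.R1[of "Lm i" "Lm j"] 3 HomD[OF map_in[OF ij(1)]] HomD[OF map_in[OF ij(2)]] by simp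
    then show ?case using D.kernel_comp 3 map_comp[OF ij] by simp
  next
    case (4 i f)
    then have "i \<in> Hom D (Dom D i) (Cod D i)" "f \<in> Hom D (Dom D i) (Cod D f)"
      by (auto simp: is_kernel_def is_kernel_of_def Hom_def)
    then show ?case using D.pushout_exists by metis
  next
    case (5 i f i' f')
    \<comment> \<open>Being a kernel passes to the pushout inside \<open>D\<close>; the image of
      \<open>i'\<close> lies in \<open>Infl\<close> because the functor carries the square to a
      pushout in \<open>C\<close>.\<close>
    then show ?case using D.kernel_pushout E.R2_stable[OF _ map_pushout[OF L]] by blast
  qed
qed

theorem proposition4p2:
  fixes C :: "('o, 'm) precat" and D :: "('p, 'n) precat"
    and Infl :: "'m set" and Lo :: "'p \<Rightarrow> 'o" and Lm :: "'n \<Rightarrow> 'm"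
  assumes "right_quasi_abelian_category D"
    and "additive_functor D C Lo Lm"
    and "preserves_cokernels D C Lm"
  shows "(right_exact_category C Infl \<longrightarrow>
            right_exact_category D {j. is_kernel D j \<and> Lm j \<in> Infl}) \<and>
         (strongly_right_exact_category C Infl \<longrightarrow>
            strongly_right_exact_category D {j. is_kernel D j \<and> Lm j \<in> Infl})"
proof (intro conjI impI)
  assume "right_exact_category C Infl"
  then show "right_exact_category D {j. is_kernel D j \<and> Lm j \<in> Infl}"
    using induced_right_exact assms by blast
next
  assume "strongly_right_exact_category C Infl"
  then interpret E: strongly_right_exact_category C Infl .
  interpret D: right_quasi_abelian_category D by fact
  interpret additive_functor D C Lo Lm by fact
  interpret J: right_exact_category D "{j. is_kernel D j \<and> Lm j \<in> Infl}"
    using induced_right_exact assms E.right_exact_category_axioms by blast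
  show "strongly_right_exact_category D {j. is_kernel D j \<and> Lm j \<in> Infl}"
  proof (unfold_locales, goal_cases)
    case (1 i p)
    then have ip: "i \<in> Hom D (Dom D i) (Cod D i)" "p \<in> Hom D (Cod D i) (Cod D p)"
      by (auto simp: Hom_def)
    note L = HomD[OF map_in[OF ip(1)]] HomD[OF map_in[OF ip(2)]]
    \<comment> \<open>A cokernel of \<open>i\<close> in \<open>D\<close> is sent to one of
      \<open>Lm i\<close>, so that R3 in \<open>C\<close> applies to
      \<open>Lm p \<cdot> Lm i\<close>.\<close>
    have "\<exists>c. is_cokernel_of C c (Lm i)"
      using 1(4) assms(3) unfolding preserves_cokernels_def by blast
    then have "Lm i \<in> Infl" using E.R3[of "Lm i" "Lm p"] L map_comp[OF ip] 1(5) by simp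
    then show ?case using D.kernel_if_comp_kernel[OF ip] 1(5) by blast
  qed
qed

end
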